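(* Convergence in kNN topology does not imply convergence in norm: if a sequence of point sets $\mathcal{Y}^{(t)}=\{y_i^{(t)}\mid i\in\mathcal{V}\}\subset\mathbb{R}^p$, $t\in\mathbb{N}$, $\mathcal{V}=\{1,\dots,N\}$, converges globally in kNN topology, then the points $y_i^{(t)}$ may or may not converge to limits as $t\to\infty$. That is, there exist $N\ge2$, $p\ge1$ and a sequence $\mathcal{Y}^{(t)}$ converging globally in kNN topology to some point set such that $y_i^{(t)}$ converges in $\mathbb{R}^p$ as $t\to\infty$ for every $i\in\mathcal{V}$; and there exist $N\ge2$, $p\ge1$ and a sequence $\mathcal{Y}^{(t)}$ converging globally in kNN topology to some point set such that, for some $i\in\mathcal{V}$, $y_i^{(t)}$ does not converge in $\mathbb{R}^p$ as $t\to\infty$.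
   Context: For an enumerated point cloud $\mathcal{Y}=\{y_i\}_{i\in\mathcal{V}}\subset\mathbb{R}^p$, $\mathcal{V}=\{1,\dots,N\}$, let $f_{ij}(\mathcal{Y})=\|y_i-y_j\|_2$. Standing assumption: all point sets considered have well-defined orderings, i.e. for each fixed $i$ the values $f_{i1},\dots,f_{iN}$ are pairwise distinct. The kNN ordering function $F$ assigns to $\mathcal{Y}$ the $N\times N$ matrix $F(\mathcal{Y})=[k_{ij}]$ with $k_{ii}=0$ and, for $j\neq i$, $k_{ij}$ the integer such that $y_j$ is the $k_{ij}$-th nearest neighbor of $y_i$; equivalently $k_{ij}=\#\{l\in\mathcal{V}:f_{il}<f_{ij}\}$. A sequence $\mathcal{Y}^{(t)}$ has global convergence in kNN topology to $\mathcal{Y}$ iff $\lim_{t\to\infty}F(\mathcal{Y}^{(t)})=F(\mathcal{Y})$, i.e. for every $\epsilon>0$ there exists $t^*$ such that $\max_{i,j}|F_{ij}(\mathcal{Y})-F_{ij}(\mathcal{Y}^{(t)})|<\epsilon$ for all $t>t^*$. *)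

theory Defs
  imports "HOL-Analysis.Analysis"
begin

(* The dimension p is quantified existentially inside the statement, so points of R^p are the
   elements of topspace (Euclidean_space p): functions nat => real vanishing from index p on.
   A point cloud is a map from indices to points; only its values on {1..N} matter. *)

definition euclid_dist :: "nat \<Rightarrow> (nat \<Rightarrow> real) \<Rightarrow> (nat \<Rightarrow> real) \<Rightarrow> real" where
  "euclid_dist p x y = L2_set (\<lambda>k. x k - y k) {..<p}"

definition point_set :: "nat \<Rightarrow> nat \<Rightarrow> (nat \<Rightarrow> nat \<Rightarrow> real) \<Rightarrow> bool" where
  "point_set N p Y \<longleftrightarrow>
     (\<forall>i\<in>{1..N}. Y i \<in> topspace (Euclidean_space p)) \<and>
     (\<forall>i\<in>{1..N}. inj_on (\<lambda>j. euclid_dist p (Y i) (Y j)) {1..N})"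

(* For j \<noteq> i the count includes the index i itself (at distance 0), so the nearest
   neighbour of y_i gets the value 1. *)
definition knn_order :: "nat \<Rightarrow> nat \<Rightarrow> (nat \<Rightarrow> nat \<Rightarrow> real) \<Rightarrow> nat \<Rightarrow> nat \<Rightarrow> nat" where
  "knn_order N p Y i j =
     card {l \<in> {1..N}. euclid_dist p (Y i) (Y l) < euclid_dist p (Y i) (Y j)}"

definition knn_converges ::
  "nat \<Rightarrow> nat \<Rightarrow> (nat \<Rightarrow> nat \<Rightarrow> nat \<Rightarrow> real) \<Rightarrow> (nat \<Rightarrow> nat \<Rightarrow> real) \<Rightarrow> bool" where
  "knn_converges N p Ys Y \<longleftrightarrow>
     (\<forall>\<epsilon>>0. \<exists>t0. \<forall>t>t0.
        Max ((\<lambda>(i, j). \<bar>real (knn_order N p Y i j) - real (knn_order N p (Ys t) i j)\<bar>)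
             ` ({1..N} \<times> {1..N})) < \<epsilon>)"

lemma knn_order_diag: "knn_order N p Y i i = 0"
proof -
  have "euclid_dist p (Y i) (Y i) \<le> euclid_dist p (Y i) (Y l)" for l
    by (simp add: euclid_dist_def L2_set_def sum_nonneg)
  then show ?thesis
    by (simp add: knn_order_def not_less)
qed

(* The library topology on Euclidean_space p is the one of the Euclidean norm, so convergence in
   Euclidean_space p is convergence in norm. *)
lemma limitin_Euclidean_space_iff_norm:
  assumes x: "\<And>t. x t \<in> topspace (Euclidean_space p)"
  shows "limitin (Euclidean_space p) x l sequentially \<longleftrightarrow>
     l \<in> topspace (Euclidean_space p) \<and> (\<lambda>t. euclid_dist p (x t) l) \<longlonglongrightarrow> 0"
    (is "?lhs \<longleftrightarrow> ?rhs")
proof -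
  have coord: "?lhs \<longleftrightarrow> l \<in> topspace (Euclidean_space p) \<and> (\<forall>k. (\<lambda>t. x t k) \<longlonglongrightarrow> l k)"
    using x by (auto simp: Euclidean_space_def limitin_subtopology limitin_componentwise)
  have "(\<forall>k. (\<lambda>t. x t k) \<longlonglongrightarrow> l k) \<longleftrightarrow> (\<lambda>t. euclid_dist p (x t) l) \<longlonglongrightarrow> 0"
    if l: "l \<in> topspace (Euclidean_space p)"
  proof
    assume lim: "\<forall>k. (\<lambda>t. x t k) \<longlonglongrightarrow> l k"
    have "(\<lambda>t. sqrt (\<Sum>k<p. (x t k - l k)\<^sup>2)) \<longlonglongrightarrow> sqrt (\<Sum>k<p. (l k - l k)\<^sup>2)"
      using lim by (intro tendsto_intros) auto
    then show "(\<lambda>t. euclid_dist p (x t) l) \<longlonglongrightarrow> 0"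
      by (simp add: euclid_dist_def L2_set_def)
  next
    assume lim: "(\<lambda>t. euclid_dist p (x t) l) \<longlonglongrightarrow> 0"
    show "\<forall>k. (\<lambda>t. x t k) \<longlonglongrightarrow> l k"
    proof
      fix k
      show "(\<lambda>t. x t k) \<longlonglongrightarrow> l k"
      proof (cases "k < p")
        case True
        have "\<bar>x t k - l k\<bar> \<le> euclid_dist p (x t) l" for t
        proof -
          have "\<bar>x t k - l k\<bar> \<le> L2_set (\<lambda>k. \<bar>x t k - l k\<bar>) {..<p}"
            using True by (intro member_le_L2_set) auto
          then show ?thesis by (simp add: euclid_dist_def L2_set_def)
        qed
        then have "(\<lambda>t. x t k - l k) \<longlonglongrightarrow> 0"
          by (intro Lim_null_comparison[OF _ lim]) auto
        then show ?thesis by (simp add: LIM_zero_iff)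
      next
        case False
        then show ?thesis using x l by (simp add: topspace_Euclidean_space)
      qed
    qed
  qed
  then show ?thesis using coord by blast
qed

end

theory Submission
  imports Defs
begin

text \<open>The kNN ordering depends only on the pairwise distances, so it does not change when a
  cloud is translated: a constant sequence converges in norm, while translates of one cloud
  escaping to infinity have constant kNN ordering and do not converge.\<close>

text \<open>Every entry of the difference is 0. With \<open>N \<ge> 1\<close> the index set is
  nonempty, so the image is exactly \<open>{0}\<close> and its \<open>Max\<close> is 0;
  \<open>Max\<close> of an empty set would have no useful value.\<close>

lemma knn_converges_if_order_eq:
  assumes "N \<ge> 1" and eq: "\<And>t. knn_order N p (Ys t) = knn_order N p Y"
  shows "knn_converges N p Ys Y"
proof -
  have "(\<lambda>(i, j). \<bar>real (knn_order N p Y i j) - real (knn_order N p (Ys t) i j)\<bar>)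
          ` ({1..N} \<times> {1..N}) = {0}" for t
    using \<open>N \<ge> 1\<close> by (force simp: eq)
  then show ?thesis
    by (simp add: knn_converges_def)
qed

definition line_pair :: "real \<Rightarrow> nat \<Rightarrow> nat \<Rightarrow> real" where
  "line_pair c i k = (if k = 0 then c + real i else 0)"

lemma euclid_dist_line_pair:
  "euclid_dist 1 (line_pair c i) (line_pair c j) = \<bar>real i - real j\<bar>"
  by (simp add: euclid_dist_def L2_set_def line_pair_def)

lemma line_pair_in_Euclidean_space: "line_pair c i \<in> topspace (Euclidean_space 1)"
  by (simp add: topspace_Euclidean_space line_pair_def)

text \<open>With two points, each sees the distances 0 and 1, so no ties arise. A third equally
  spaced point would break this: the middle one would have two neighbours at distance 1.\<close>

lemma point_set_line_pair: "point_set 2 1 (line_pair c)"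
proof -
  have "{1..2} = {1, 2 :: nat}" by auto
  then show ?thesis
    by (simp add: point_set_def line_pair_in_Euclidean_space[simplified]
        euclid_dist_line_pair[simplified])
qed

text \<open>The shifts \<open>c t\<close> and \<open>d\<close> are arbitrary because they cancel in
  every distance; this lets one lemma serve both halves of the theorem.\<close>

lemma knn_converges_line_pair: "knn_converges 2 1 (\<lambda>t. line_pair (c t)) (line_pair d)"
  by (rule knn_converges_if_order_eq)
    (simp_all add: fun_eq_iff knn_order_def euclid_dist_line_pair[simplified])

text \<open>In dimension 1 the norm is the absolute value of coordinate 0, so a limit
  \<open>l\<close> of the \<open>i\<close>-th point forces \<open>c\<close> to tend to
  \<open>l 0 - real i\<close>. The contrapositive rules out limits for unbounded shifts.\<close>

lemma line_pair_limit_imp_convergent: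
  assumes "limitin (Euclidean_space 1) (\<lambda>t. line_pair (c t) i) l sequentially"
  shows "convergent c"
proof -
  have "(\<lambda>t. euclid_dist 1 (line_pair (c t) i) l) \<longlonglongrightarrow> 0"
    using assms
    by (simp only: limitin_Euclidean_space_iff_norm[OF line_pair_in_Euclidean_space])
  then have "(\<lambda>t. c t - (l 0 - real i)) \<longlonglongrightarrow> 0"
    by (simp add: euclid_dist_def L2_set_def line_pair_def tendsto_rabs_zero_iff diff_diff_eq2)
  then show ?thesis
    unfolding LIM_zero_iff by (rule convergentI)
qed

theorem theorem3p17:
  shows
    "(\<exists>N p :: nat. N \<ge> 2 \<and> p \<ge> 1 \<and>
        (\<exists>(Ys :: nat \<Rightarrow> nat \<Rightarrow> nat \<Rightarrow> real) (Y :: nat \<Rightarrow> nat \<Rightarrow> real).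
           (\<forall>t. point_set N p (Ys t)) \<and> point_set N p Y \<and> knn_converges N p Ys Y \<and>
           (\<forall>i\<in>{1..N}. \<exists>l. limitin (Euclidean_space p) (\<lambda>t. Ys t i) l sequentially))) \<and>
     (\<exists>N p :: nat. N \<ge> 2 \<and> p \<ge> 1 \<and>
        (\<exists>(Ys :: nat \<Rightarrow> nat \<Rightarrow> nat \<Rightarrow> real) (Y :: nat \<Rightarrow> nat \<Rightarrow> real).
           (\<forall>t. point_set N p (Ys t)) \<and> point_set N p Y \<and> knn_converges N p Ys Y \<and>
           (\<exists>i\<in>{1..N}. \<not> (\<exists>l. limitin (Euclidean_space p) (\<lambda>t. Ys t i) l sequentially))))"
proof (rule conjI)
  \<comment> \<open>A constant sequence converges to its value as soon as that value lies in the
    space.\<close>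
  have "limitin (Euclidean_space 1) (\<lambda>t. line_pair 0 i) (line_pair 0 i) sequentially" for i
    using line_pair_in_Euclidean_space by (simp only: Abstract_Limits.limitin_const_iff)
  then have "\<forall>i\<in>{1..2}. \<exists>l. limitin (Euclidean_space 1) (\<lambda>t. line_pair 0 i) l sequentially"
    by blast
  then show "\<exists>N p :: nat. N \<ge> 2 \<and> p \<ge> 1 \<and>
      (\<exists>(Ys :: nat \<Rightarrow> nat \<Rightarrow> nat \<Rightarrow> real) (Y :: nat \<Rightarrow> nat \<Rightarrow> real).
         (\<forall>t. point_set N p (Ys t)) \<and> point_set N p Y \<and> knn_converges N p Ys Y \<and>
         (\<forall>i\<in>{1..N}. \<exists>l. limitin (Euclidean_space p) (\<lambda>t. Ys t i) l sequentially))"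
    by - (rule exI[of _ 2], rule exI[of _ 1], intro conjI order_refl,
        rule exI[of _ "\<lambda>t. line_pair 0"], rule exI[of _ "line_pair 0"],
        intro conjI allI point_set_line_pair knn_converges_line_pair)
next
  \<comment> \<open>The embedding of the naturals tends to infinity, which excludes a finite
    limit.\<close>
  have "\<not> convergent real"
    using not_tendsto_and_filterlim_at_infinity[OF trivial_limit_sequentially _
        filterlim_at_top_imp_at_infinity[OF filterlim_real_sequentially]]
    by (auto simp: convergent_def)
  then have nolim: "\<not> (\<exists>l. limitin (Euclidean_space 1) (\<lambda>t. line_pair (real t) 1) l sequentially)"
    using line_pair_limit_imp_convergent by blast
  have "\<exists>i\<in>{1..2}. \<not> (\<exists>l. limitin (Euclidean_space 1) (\<lambda>t. line_pair (real t) i) l sequentially)"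
    using nolim by (rule bexI[where x = 1]) simp
  then show "\<exists>N p :: nat. N \<ge> 2 \<and> p \<ge> 1 \<and>
      (\<exists>(Ys :: nat \<Rightarrow> nat \<Rightarrow> nat \<Rightarrow> real) (Y :: nat \<Rightarrow> nat \<Rightarrow> real).
         (\<forall>t. point_set N p (Ys t)) \<and> point_set N p Y \<and> knn_converges N p Ys Y \<and>
         (\<exists>i\<in>{1..N}. \<not> (\<exists>l. limitin (Euclidean_space p) (\<lambda>t. Ys t i) l sequentially)))"
    \<comment> \<open>The target \<open>line_pair 0\<close> is not a limit in norm: any translate
      has the same kNN ordering.\<close>
    by - (rule exI[of _ 2], rule exI[of _ 1], intro conjI order_refl,
        rule exI[of _ "\<lambda>t. line_pair (real t)"], rule exI[of _ "line_pair 0"],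
        intro conjI allI point_set_line_pair knn_converges_line_pair)
qed

end
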